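(* If $f_1=f_1(x^1)$ depends only on $x^1$ and $f_2=f_2(x^3)$ depends only on $x^3$, then the following assertions are equivalent: (1) $(I,\tilde g)$ is a flat Riemannian manifold; (2) $f_2$ is constant, or $f_2(x^3)=\frac{c_1}{x^3-c_2}$, where $c_1\in\mathbb R\setminus\{0\}$ and $c_2\in\mathbb R\setminus I_3$.
   Context: Let $I=I_1\times I_2\times I_3\subseteq\mathbb R^3$ with $I_1,I_2,I_3\subseteq\mathbb R$ open intervals and standard coordinates $x^1,x^2,x^3$. Let $f_1,f_2$ be smooth nowhere zero functions on $I$ and endow $I$ with the Riemannian metric $\tilde g=\frac{1}{f_1^2}dx^1\otimes dx^1+\frac{1}{f_2^2}dx^2\otimes dx^2+dx^3\otimes dx^3$. Flat means that the Riemann curvature tensor of $\tilde g$ vanishes identically. *)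

theory Defs
  imports "HOL-Analysis.Analysis"
begin

definition partial_deriv :: "'n::finite \<Rightarrow> (real ^ 'n \<Rightarrow> real) \<Rightarrow> real ^ 'n \<Rightarrow> real" where
  "partial_deriv i f x = deriv (\<lambda>t. f (x + t *\<^sub>R axis i 1)) 0"

text \<open>Both notions below are meant for open sets \<open>S\<close>.\<close>

primrec Ck_on :: "nat \<Rightarrow> (real ^ 'n::finite) set \<Rightarrow> (real ^ 'n \<Rightarrow> real) \<Rightarrow> bool" where
  "Ck_on 0 S f \<longleftrightarrow> continuous_on S f"
| "Ck_on (Suc k) S f \<longleftrightarrow> f differentiable_on S \<and> (\<forall>i. Ck_on k S (partial_deriv i f))"

definition smooth_on :: "(real ^ 'n::finite) set \<Rightarrow> (real ^ 'n \<Rightarrow> real) \<Rightarrow> bool" where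
  "smooth_on S f \<longleftrightarrow> (\<forall>k. Ck_on k S f)"

text \<open>A metric on an open set \<open>S\<close> is given by its matrix \<open>g x $ i $ j\<close> in the standard
  coordinates; the values outside \<open>S\<close> are irrelevant.\<close>

definition riemannian_metric_on ::
    "(real ^ 'n::finite) set \<Rightarrow> (real ^ 'n \<Rightarrow> real ^ 'n ^ 'n) \<Rightarrow> bool" where
  "riemannian_metric_on S g \<longleftrightarrow>
     (\<forall>i j. smooth_on S (\<lambda>x. g x $ i $ j)) \<and>
     (\<forall>x\<in>S. transpose (g x) = g x \<and> (\<forall>v. v \<noteq> 0 \<longrightarrow> v \<bullet> (g x *v v) > 0))"

text \<open>\<open>christoffel g k i j\<close> is $\Gamma^k_{ij}$, the Christoffel symbol of the Levi-Civita
  connection of \<open>g\<close>.\<close>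

definition christoffel ::
    "(real ^ 'n::finite \<Rightarrow> real ^ 'n ^ 'n) \<Rightarrow> 'n \<Rightarrow> 'n \<Rightarrow> 'n \<Rightarrow> real ^ 'n \<Rightarrow> real" where
  "christoffel g k i j x =
     (\<Sum>l\<in>UNIV. matrix_inv (g x) $ k $ l *
        (partial_deriv i (\<lambda>y. g y $ j $ l) x + partial_deriv j (\<lambda>y. g y $ i $ l) x
          - partial_deriv l (\<lambda>y. g y $ i $ j) x)) / 2"

text \<open>\<open>riemann_coeff g l i j k\<close> is the component along $\partial_l$ of
  $R(\partial_i,\partial_j)\partial_k =
    \nabla_i\nabla_j\partial_k - \nabla_j\nabla_i\partial_k$.\<close>

definition riemann_coeff ::
    "(real ^ 'n::finite \<Rightarrow> real ^ 'n ^ 'n) \<Rightarrow> 'n \<Rightarrow> 'n \<Rightarrow> 'n \<Rightarrow> 'n \<Rightarrow> real ^ 'n \<Rightarrow> real" where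
  "riemann_coeff g l i j k x =
     partial_deriv i (christoffel g l j k) x - partial_deriv j (christoffel g l i k) x
     + (\<Sum>m\<in>UNIV. christoffel g l i m x * christoffel g m j k x
                 - christoffel g l j m x * christoffel g m i k x)"

definition riemann_tensor ::
    "(real ^ 'n::finite \<Rightarrow> real ^ 'n ^ 'n) \<Rightarrow> real ^ 'n \<Rightarrow>
     real ^ 'n \<Rightarrow> real ^ 'n \<Rightarrow> real ^ 'n \<Rightarrow> real ^ 'n" where
  "riemann_tensor g x u v w =
     (\<chi> l. \<Sum>i\<in>UNIV. \<Sum>j\<in>UNIV. \<Sum>k\<in>UNIV. riemann_coeff g l i j k x * u $ i * v $ j * w $ k)"

definition flat_riemannian_on ::
    "(real ^ 'n::finite) set \<Rightarrow> (real ^ 'n \<Rightarrow> real ^ 'n ^ 'n) \<Rightarrow> bool" where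
  "flat_riemannian_on S g \<longleftrightarrow>
     riemannian_metric_on S g \<and> (\<forall>x\<in>S. \<forall>u v w. riemann_tensor g x u v w = 0)"

definition open_interval :: "real set \<Rightarrow> bool" where
  "open_interval J \<longleftrightarrow> open J \<and> is_interval J \<and> J \<noteq> {}"

definition box3 :: "real set \<Rightarrow> real set \<Rightarrow> real set \<Rightarrow> (real ^ 3) set" where
  "box3 I1 I2 I3 = {x. x $ 1 \<in> I1 \<and> x $ 2 \<in> I2 \<and> x $ 3 \<in> I3}"

definition depends_only_on_coord :: "'n::finite \<Rightarrow> (real ^ 'n) set \<Rightarrow> (real ^ 'n \<Rightarrow> real) \<Rightarrow> bool" where
  "depends_only_on_coord i S f \<longleftrightarrow> (\<forall>x\<in>S. \<forall>y\<in>S. x $ i = y $ i \<longrightarrow> f x = f y)"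

definition g_tilde :: "(real ^ 3 \<Rightarrow> real) \<Rightarrow> (real ^ 3 \<Rightarrow> real) \<Rightarrow> real ^ 3 \<Rightarrow> real ^ 3 ^ 3" where
  "g_tilde f1 f2 x =
     vector [vector [1 / (f1 x)\<^sup>2, 0, 0],
             vector [0, 1 / (f2 x)\<^sup>2, 0],
             vector [0, 0, 1]]"

end

theory Submission
  imports Defs
begin

text \<open>
  Put \<open>h = 1 / f2\<close>, so that the metric is \<open>dx1\<^sup>2 / f1\<^sup>2 + h(x3)\<^sup>2 dx2\<^sup>2 + dx3\<^sup>2\<close>. The first
  summand is the metric of a line and does not contribute to the curvature; the other two form
  a warped product with Gauss curvature \<open>- h'' / h\<close>. Hence the metric is flat iff \<open>h'' = 0\<close>, i.e.
  iff \<open>h\<close> is affine on \<open>I3\<close>. The zero of a nonconstant affine \<open>h\<close> is \<open>c2\<close>, which is outside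
  \<open>I3\<close> because \<open>h\<close> does not vanish there.
\<close>

section \<open>Partial derivatives and closure properties of C^k functions on open sets\<close>

lemma partial_deriv_has_derivative:
  assumes "f differentiable (at x)"
  shows "((\<lambda>t. f (x + t *\<^sub>R axis i 1)) has_real_derivative partial_deriv i f x) (at 0)"
proof -
  have "f differentiable (at (x + 0 *\<^sub>R axis i 1))" using assms by simp
  moreover have "(\<lambda>t. x + t *\<^sub>R axis i 1) differentiable (at (0::real))" by simp
  ultimately have "(f \<circ> (\<lambda>t. x + t *\<^sub>R axis i 1)) differentiable (at (0::real))"
    using differentiable_chain_at by blast
  then have "(\<lambda>t. f (x + t *\<^sub>R axis i 1)) field_differentiable (at 0)"
    by (simp add: o_def field_differentiable_def real_differentiable_def)
  then show ?thesis
    unfolding partial_deriv_def by (rule DERIV_deriv_iff_field_differentiable[THEN iffD2])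
qed

lemma eventually_line_in_open:
  fixes x :: "real ^ 'n::finite"
  assumes "open S" "x \<in> S"
  shows "eventually (\<lambda>t. x + t *\<^sub>R axis i 1 \<in> S) (nhds (0::real))"
proof -
  have "isCont (\<lambda>t. x + t *\<^sub>R axis i 1) (0::real)" by (intro continuous_intros)
  then have "((\<lambda>t. x + t *\<^sub>R axis i 1) \<longlongrightarrow> x) (nhds (0::real))"
    unfolding continuous_at by (simp add: tendsto_nhds_iff)
  then show ?thesis using assms by (rule topological_tendstoD)
qed

text \<open>A short coordinate segment through \<open>x\<close> stays in the open set, and
  \<open>deriv\<close> at 0 sees only the germ of the restriction to it.\<close>

lemma partial_deriv_cong:
  assumes "open S" "x \<in> S" "\<And>y. y \<in> S \<Longrightarrow> f y = g y"
  shows "partial_deriv i f x = partial_deriv i g x"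
  unfolding partial_deriv_def
  by (intro deriv_cong_ev eventually_mono[OF eventually_line_in_open[OF assms(1,2), of i]])
     (auto simp: assms(3))

text \<open>The rules for partial derivatives of sums, products and inverses give equalities at
  points of \<open>S\<close> only; this carries regularity across such equalities. The induction
  varies \<open>f\<close> and \<open>g\<close> because its step passes to partial
  derivatives.\<close>

lemma Ck_on_cong:
  assumes "open S" "\<And>x. x \<in> S \<Longrightarrow> f x = g x" "Ck_on k S f"
  shows "Ck_on k S g"
  using assms(2,3)
proof (induction k arbitrary: f g)
  case 0
  then show ?case using continuous_on_cong by force
next
  case (Suc k)
  \<comment> \<open>The radius 1 is arbitrary, since \<open>f\<close> and \<open>g\<close> agree on
    all of \<open>S\<close>.\<close>
  have "g differentiable_on S"
    using Suc.prems by (auto simp: differentiable_on_def intro: differentiable_transform_within[OF _ zero_less_one])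
  moreover have "Ck_on k S (partial_deriv i g)" for i
    by (rule Suc.IH[of "partial_deriv i f"])
       (use Suc.prems in \<open>auto intro: partial_deriv_cong[OF assms(1)]\<close>)
  ultimately show ?case by simp
qed

lemma Ck_on_Suc_imp: "Ck_on (Suc k) S f \<Longrightarrow> Ck_on k S f"
  by (induction k arbitrary: f) (auto simp: differentiable_imp_continuous_on)

lemma partial_deriv_const [simp]: "partial_deriv i (\<lambda>x. c) = (\<lambda>x. 0)"
  by (simp add: partial_deriv_def fun_eq_iff)

lemma Ck_on_const: "Ck_on k S (\<lambda>x. c)"
  by (induction k arbitrary: c) auto

lemma partial_deriv_uminus:
  assumes "f differentiable (at x)"
  shows "partial_deriv i (\<lambda>x. - f x) x = - partial_deriv i f x"
  by (subst partial_deriv_def)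
     (intro DERIV_imp_deriv DERIV_minus partial_deriv_has_derivative assms)

lemma partial_deriv_add:
  assumes "f differentiable (at x)" "g differentiable (at x)"
  shows "partial_deriv i (\<lambda>x. f x + g x) x = partial_deriv i f x + partial_deriv i g x"
  by (subst partial_deriv_def)
     (intro DERIV_imp_deriv DERIV_add partial_deriv_has_derivative assms)

lemma partial_deriv_mult:
  assumes "f differentiable (at x)" "g differentiable (at x)"
  shows "partial_deriv i (\<lambda>x. f x * g x) x = partial_deriv i f x * g x + partial_deriv i g x * f x"
  using DERIV_mult[OF assms[THEN partial_deriv_has_derivative], of i]
  by (subst partial_deriv_def) (auto dest: DERIV_imp_deriv)

lemma partial_deriv_inverse:
  assumes "f differentiable (at x)" "f x \<noteq> 0"
  shows "partial_deriv i (\<lambda>x. inverse (f x)) x = - partial_deriv i f x * (inverse (f x) * inverse (f x))"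
  using DERIV_inverse_fun[OF assms(1)[THEN partial_deriv_has_derivative], of i] assms(2)
  by (subst partial_deriv_def) (auto dest!: DERIV_imp_deriv simp: power2_eq_square)

lemma Ck_on_uminus:
  assumes "open S" "Ck_on k S f"
  shows "Ck_on k S (\<lambda>x. - f x)"
  using assms(2)
proof (induction k arbitrary: f)
  case (Suc k)
  have "Ck_on k S (partial_deriv i (\<lambda>x. - f x))" for i
    by (rule Ck_on_cong[OF assms(1) _ Suc.IH[of "partial_deriv i f"]])
       (use Suc.prems assms(1) in \<open>auto simp: partial_deriv_uminus differentiable_on_eq_differentiable_at\<close>)
  with Suc.prems show ?case by (simp add: differentiable_on_minus)
qed (simp add: continuous_on_minus)

lemma Ck_on_add:
  assumes "open S" "Ck_on k S f" "Ck_on k S g"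
  shows "Ck_on k S (\<lambda>x. f x + g x)"
  using assms(2,3)
proof (induction k arbitrary: f g)
  case (Suc k)
  have "Ck_on k S (partial_deriv i (\<lambda>x. f x + g x))" for i
    by (rule Ck_on_cong[OF assms(1) _ Suc.IH[of "partial_deriv i f" "partial_deriv i g"]])
       (use Suc.prems assms(1) in \<open>auto simp: partial_deriv_add differentiable_on_eq_differentiable_at\<close>)
  with Suc.prems show ?case by (simp add: differentiable_on_add)
qed (simp add: continuous_on_add)

text \<open>The product rule leaves one factor undifferentiated in each summand. That factor is in
  class k + 1 and must first be lowered to class k by \<open>Ck_on_Suc_imp\<close> before the
  induction hypothesis applies.\<close>

lemma Ck_on_mult:
  assumes "open S" "Ck_on k S f" "Ck_on k S g"
  shows "Ck_on k S (\<lambda>x. f x * g x)"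
  using assms(2,3)
proof (induction k arbitrary: f g)
  case (Suc k)
  have "Ck_on k S (partial_deriv i (\<lambda>x. f x * g x))" for i
    by (rule Ck_on_cong[OF assms(1) _ Ck_on_add[OF assms(1) 
            Suc.IH[of "partial_deriv i f" g] Suc.IH[of "partial_deriv i g" f]]])
       (use Suc.prems assms(1) Ck_on_Suc_imp[OF Suc.prems(1)] Ck_on_Suc_imp[OF Suc.prems(2)]
         in \<open>auto simp: partial_deriv_mult differentiable_on_eq_differentiable_at\<close>)
  with Suc.prems show ?case by (simp add: differentiable_on_mult)
qed (simp add: continuous_on_mult)

text \<open>The derivative of 1/f is -f' times the square of 1/f, so the induction hypothesis is
  needed only for the same \<open>f\<close>, and closure under products does the rest.\<close>

lemma Ck_on_inverse:
  assumes "open S" "\<And>x. x \<in> S \<Longrightarrow> f x \<noteq> 0" "Ck_on k S f"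
  shows "Ck_on k S (\<lambda>x. inverse (f x))"
  using assms(3)
proof (induction k)
  case 0
  then show ?case using assms(2) by (auto intro!: continuous_on_inverse)
next
  case (Suc k)
  have IH: "Ck_on k S (\<lambda>x. inverse (f x))"
    by (rule Suc.IH[OF Ck_on_Suc_imp[OF Suc.prems]])
  have "Ck_on k S (partial_deriv i (\<lambda>x. inverse (f x)))" for i
    by (rule Ck_on_cong[OF assms(1) _ Ck_on_mult[OF assms(1) 
            Ck_on_uminus[OF assms(1), of k "partial_deriv i f"] Ck_on_mult[OF assms(1) IH IH]]])
       (use Suc.prems assms(1,2)
         in \<open>auto simp: partial_deriv_inverse differentiable_on_eq_differentiable_at\<close>)
  moreover have "(\<lambda>x. inverse (f x)) differentiable_on S"
    using Suc.prems assms(1,2)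
    by (auto simp: differentiable_on_eq_differentiable_at intro!: differentiable_inverse)
  ultimately show ?case by simp
qed

lemma smooth_on_const: "smooth_on S (\<lambda>x. c)"
  by (simp add: smooth_on_def Ck_on_const)

lemma smooth_on_inverse_square:
  assumes "open S" "\<And>x. x \<in> S \<Longrightarrow> f x \<noteq> 0" "smooth_on S f"
  shows "smooth_on S (\<lambda>x. 1 / (f x)\<^sup>2)"
proof -
  have "Ck_on k S (\<lambda>x. inverse (f x) * inverse (f x))" for k
    using assms by (intro Ck_on_mult Ck_on_inverse) (auto simp: smooth_on_def)
  then show ?thesis by (simp add: smooth_on_def power2_eq_square field_simps)
qed

section \<open>Functions of a single coordinate on an open set\<close>

text \<open>No differentiability is needed: if \<open>p\<close> is not differentiable, then both sides are the
  same junk value of \<open>deriv\<close>.\<close>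

lemma partial_deriv_coord:
  assumes "open S" "x \<in> S" "\<And>y. y \<in> S \<Longrightarrow> F y = p (y $ k)"
  shows "partial_deriv i F x = (if i = k then deriv p (x $ k) else 0)"
proof -
  have *: "partial_deriv i F x = deriv (\<lambda>t. p ((x + t *\<^sub>R axis i 1) $ k)) 0"
    using partial_deriv_cong[of S x F "\<lambda>x. p (x $ k)" i] assms by (simp add: partial_deriv_def)
  show ?thesis
  proof (cases "i = k")
    case True
    have "deriv (\<lambda>t. p (x $ k + t)) 0 = deriv p (x $ k)"
      by (simp add: deriv_def DERIV_shift[symmetric] add.commute)
    with True * show ?thesis by (simp add: axis_def)
  next
    case False
    then show ?thesis using * by (simp add: axis_def)
  qed
qed

text \<open>Along the k-th axis \<open>F\<close> is \<open>p\<close> translated by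
  \<open>x $ k\<close>, so differentiability of \<open>F\<close> makes \<open>deriv p\<close> a
  genuine derivative. This is the passage from functions on the box to calculus in one
  variable.\<close>

lemma differentiable_coord:
  assumes "open S" "x \<in> S" "\<And>y. y \<in> S \<Longrightarrow> F y = p (y $ k)" "F differentiable (at x)"
  shows "(p has_real_derivative deriv p (x $ k)) (at (x $ k))"
proof -
  have "((\<lambda>t. F (x + t *\<^sub>R axis k 1)) has_real_derivative deriv p (x $ k)) (at 0)"
    using partial_deriv_has_derivative[OF assms(4), of k]
      partial_deriv_coord[where i = k and p = p and k = k, OF assms(1-3)]
    by simp
  moreover have "eventually (\<lambda>t. F (x + t *\<^sub>R axis k 1) = p (t + x $ k)) (nhds 0)"
    by (rule eventually_mono[OF eventually_line_in_open[OF assms(1,2), of k]])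
       (simp add: assms(3) axis_def add.commute)
  ultimately have "((\<lambda>t. p (t + x $ k)) has_real_derivative deriv p (x $ k)) (at 0)"
    by (simp add: DERIV_cong_ev[OF refl _ refl])
  then show ?thesis using DERIV_shift[of p _ 0 "x $ k"] by simp
qed

lemma open_box3:
  assumes "open I1" "open I2" "open I3"
  shows "open (box3 I1 I2 I3)"
proof -
  have *: "open {x :: real ^ 3. x $ k \<in> J}" if "open J" for k J
    using open_vimage[OF that, of "\<lambda>x. x $ k"] by (simp add: vimage_def continuous_on_component)
  have "box3 I1 I2 I3 = {x. x $ 1 \<in> I1} \<inter> {x. x $ 2 \<in> I2} \<inter> {x. x $ 3 \<in> I3}"
    by (auto simp: box3_def)
  then show ?thesis using assms by (auto intro!: open_Int *)
qed

text \<open>The profile \<open>p\<close> evaluates \<open>f\<close> at a chosen point of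
  \<open>S\<close> with the prescribed coordinate; by hypothesis the choice does not affect the
  value. The witness is fixed by unification with the final \<open>show\<close>.\<close>

lemma depends_only_on_coordE:
  assumes "depends_only_on_coord k S f"
  obtains p where "\<And>x. x \<in> S \<Longrightarrow> f x = p (x $ k)"
proof
  fix x assume "x \<in> S"
  then have "\<exists>y. y \<in> S \<and> y $ k = x $ k" by blast
  then have "(SOME y. y \<in> S \<and> y $ k = x $ k) \<in> S \<and> (SOME y. y \<in> S \<and> y $ k = x $ k) $ k = x $ k"
    by (rule someI_ex)
  then show "f x = (\<lambda>t. f (SOME y. y \<in> S \<and> y $ k = t)) (x $ k)"
    using assms \<open>x \<in> S\<close> unfolding depends_only_on_coord_def by metis
qed

section \<open>The metric, its inverse matrix and the components of the curvature tensor\<close>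

lemma matrix_inv_diag3:
  fixes a b c :: real
  assumes "a \<noteq> 0" "b \<noteq> 0" "c \<noteq> 0"
  shows "matrix_inv (vector [vector [a, 0, 0], vector [0, b, 0], vector [0, 0, c]] :: real ^ 3 ^ 3) =
    vector [vector [1 / a, 0, 0], vector [0, 1 / b, 0], vector [0, 0, 1 / c]]" (is "matrix_inv ?A = ?B")
proof -
  have "?A ** ?B = mat 1" "?B ** ?A = mat 1"
    using assms by (simp_all add: vec_eq_iff forall_3 matrix_matrix_mult_def sum_3 mat_def)
  \<comment> \<open>\<open>matrix_inv\<close> is a Hilbert choice, so its defining property needs a
    witness, which is \<open>?B\<close>. Multiplying by \<open>?B\<close> from the left then
    identifies the chosen inverse with \<open>?B\<close>.\<close>
  then have "?A ** matrix_inv ?A = mat 1" "?B ** ?A = mat 1"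
    unfolding matrix_inv_def by (metis (mono_tags, lifting) someI_ex)+
  then show ?thesis
    using matrix_mul_assoc[of ?B ?A "matrix_inv ?A"] by simp
qed

text \<open>Flatness as defined includes being a Riemannian metric. Positivity holds because the
  quadratic form is a sum of three squares that vanish together only at the zero vector.\<close>

lemma riemannian_metric_g_tilde:
  assumes "open S" "smooth_on S f1" "smooth_on S f2"
    "\<And>x. x \<in> S \<Longrightarrow> f1 x \<noteq> 0" "\<And>x. x \<in> S \<Longrightarrow> f2 x \<noteq> 0"
  shows "riemannian_metric_on S (g_tilde f1 f2)"
proof -
  have "smooth_on S (\<lambda>x. g_tilde f1 f2 x $ i $ j)" for i j
    using exhaust_3[of i] exhaust_3[of j] assms
    by (elim disjE) (simp_all add: g_tilde_def smooth_on_const smooth_on_inverse_square)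
  moreover have "transpose (g_tilde f1 f2 x) = g_tilde f1 f2 x" for x
    by (simp add: g_tilde_def vec_eq_iff forall_3 transpose_def)
  moreover have "v \<bullet> (g_tilde f1 f2 x *v v) > 0" if "x \<in> S" "v \<noteq> 0" for x v
  proof -
    have "v \<bullet> (g_tilde f1 f2 x *v v) = (v $ 1 / f1 x)\<^sup>2 + (v $ 2 / f2 x)\<^sup>2 + (v $ 3)\<^sup>2"
      by (simp add: g_tilde_def inner_vec_def matrix_vector_mult_def sum_3 power2_eq_square)
    moreover have "v $ 1 / f1 x \<noteq> 0 \<or> v $ 2 / f2 x \<noteq> 0 \<or> v $ 3 \<noteq> 0"
      using that assms(4,5)[of x] by (auto simp: vec_eq_iff forall_3)
    ultimately show ?thesis
      by (smt (verit) zero_le_power2 zero_eq_power2)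
  qed
  ultimately show ?thesis by (simp add: riemannian_metric_on_def)
qed

lemma riemann_tensor_axis:
  "riemann_tensor g x (axis i 1) (axis j 1) (axis k 1) $ l = riemann_coeff g l i j k x"
proof -
  have *: "c * axis i (1::real) $ m = (if m = i then c else 0)" for c and i m :: 'a
    by (simp add: axis_def)
  show ?thesis
    by (simp add: riemann_tensor_def *)
qed

text \<open>Multilinearity: the components are the values on basis vectors, and every value is a
  linear combination of components.\<close>

lemma riemann_tensor_eq_0_iff:
  "(\<forall>u v w. riemann_tensor g x u v w = 0) \<longleftrightarrow> (\<forall>l i j k. riemann_coeff g l i j k x = 0)"
proof
  assume "\<forall>u v w. riemann_tensor g x u v w = 0"
  then show "\<forall>l i j k. riemann_coeff g l i j k x = 0"
    by (metis riemann_tensor_axis zero_index)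
qed (simp add: riemann_tensor_def vec_eq_iff)

text \<open>Two integrations: convexity of \<open>J\<close> makes \<open>h'\<close> a single
  constant \<open>a\<close>, and then makes \<open>h t - a * t\<close> a single constant
  \<open>b\<close>.\<close>

lemma second_derivative_zero_imp_affine:
  fixes h :: "real \<Rightarrow> real"
  assumes "is_interval J"
    and "\<And>t. t \<in> J \<Longrightarrow> (h has_real_derivative h' t) (at t)"
    and "\<And>t. t \<in> J \<Longrightarrow> (h' has_real_derivative 0) (at t)"
  obtains a b where "\<And>t. t \<in> J \<Longrightarrow> h t = a * t + b"
proof -
  have J: "convex J" using assms(1) by (simp add: is_interval_convex)
  have "\<exists>a. \<forall>t\<in>J. h' t = a"
    using assms(3) by (intro has_field_derivative_zero_constant[OF J]) (auto intro: DERIV_subset)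
  then obtain a where a: "\<And>t. t \<in> J \<Longrightarrow> h' t = a" by blast
  have "((\<lambda>t. h t - a * t) has_real_derivative 0) (at t)" if "t \<in> J" for t
    using assms(2)[OF that] a[OF that] by (auto intro!: derivative_eq_intros)
  then have "\<exists>b. \<forall>t\<in>J. h t - a * t = b"
    by (intro has_field_derivative_zero_constant[OF J]) (auto intro: DERIV_subset)
  then obtain b where b: "\<And>t. t \<in> J \<Longrightarrow> h t - a * t = b" by blast
  have "h t = a * t + b" if "t \<in> J" for t
    using b[OF that] by simp
  then show thesis by (rule that)
qed

section \<open>Christoffel symbols and curvature of the warped metric\<close>

context
  fixes S :: "(real ^ 3) set" and f1 f2 :: "real ^ 3 \<Rightarrow> real" and p h h' h'' :: "real \<Rightarrow> real"
  assumes S: "open S"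
    and f1: "\<And>x. x \<in> S \<Longrightarrow> f1 x = p (x $ 1)" "\<And>x. x \<in> S \<Longrightarrow> f1 x \<noteq> 0"
    and f2: "\<And>x. x \<in> S \<Longrightarrow> f2 x = 1 / h (x $ 3)" "\<And>x. x \<in> S \<Longrightarrow> f2 x \<noteq> 0"
    and h': "\<And>x. x \<in> S \<Longrightarrow> (h has_real_derivative h' (x $ 3)) (at (x $ 3))"
    and h'': "\<And>x. x \<in> S \<Longrightarrow> (h' has_real_derivative h'' (x $ 3)) (at (x $ 3))"
begin

text \<open>Division by zero yields 0, so a zero of \<open>h\<close> would be a zero of
  \<open>f2\<close>.\<close>

lemma h_nonzero: "x \<in> S \<Longrightarrow> h (x $ 3) \<noteq> 0"
  using f2[of x] by auto

text \<open>The only nonconstant entries are 1/p^2 at position (1,1) and h^2 at position (2,2). The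
  derivative of the former stays an unevaluated \<open>deriv\<close>: it enters the curvature only
  through Gamma^1_11, whose contributions cancel.\<close>

lemma partial_deriv_g_tilde:
  assumes "x \<in> S"
  shows "partial_deriv i (\<lambda>y. g_tilde f1 f2 y $ j $ k) x =
    (if i = 1 \<and> j = 1 \<and> k = 1 then deriv (\<lambda>t. 1 / (p t)\<^sup>2) (x $ 1)
     else if i = 3 \<and> j = 2 \<and> k = 2 then 2 * h (x $ 3) * h' (x $ 3) else 0)"
proof -
  have 1: "partial_deriv i (\<lambda>y. 1 / (f1 y)\<^sup>2) x =
      (if i = 1 then deriv (\<lambda>t. 1 / (p t)\<^sup>2) (x $ 1) else 0)" for i
    by (rule partial_deriv_coord[OF S assms]) (simp add: f1)
  have "deriv (\<lambda>t. (h t)\<^sup>2) (x $ 3) = 2 * h (x $ 3) * h' (x $ 3)"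
    using h'[OF assms] by (auto intro!: DERIV_imp_deriv derivative_eq_intros)
  then have 2: "partial_deriv i (\<lambda>y. 1 / (f2 y)\<^sup>2) x =
      (if i = 3 then 2 * h (x $ 3) * h' (x $ 3) else 0)" for i
    using partial_deriv_coord[OF S assms, of "\<lambda>y. 1 / (f2 y)\<^sup>2" "\<lambda>t. (h t)\<^sup>2" 3 i]
    by (simp add: f2(1) power_divide)
  show ?thesis
    using exhaust_3[of j] exhaust_3[of k]
    by (elim disjE) (simp_all add: g_tilde_def 1 2)
qed

text \<open>The inverse metric is diagonal, so only the summand l = k survives. Apart from
  Gamma^1_11 these are the symbols of the warped surface metric h^2 (dx2)^2 + (dx3)^2.\<close>

lemma christoffel_g_tilde:
  assumes "x \<in> S"
  shows "christoffel (g_tilde f1 f2) k i j x =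
    (if k = 1 \<and> i = 1 \<and> j = 1 then (p (x $ 1))\<^sup>2 * deriv (\<lambda>t. 1 / (p t)\<^sup>2) (x $ 1) / 2
     else if k = 2 \<and> (i = 2 \<and> j = 3 \<or> i = 3 \<and> j = 2) then h' (x $ 3) / h (x $ 3)
     else if k = 3 \<and> i = 2 \<and> j = 2 then - (h (x $ 3) * h' (x $ 3)) else 0)"
proof -
  have "matrix_inv (g_tilde f1 f2 x) =
      vector [vector [(p (x $ 1))\<^sup>2, 0, 0], vector [0, 1 / (h (x $ 3))\<^sup>2, 0], vector [0, 0, 1]]"
    using f1[OF assms] f2[OF assms] h_nonzero[OF assms]
    unfolding g_tilde_def by (subst matrix_inv_diag3) (auto simp: power_divide)
  then show ?thesis
    using exhaust_3[of k] exhaust_3[of i] exhaust_3[of j] h_nonzero[OF assms]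
    by (elim disjE)
       (simp_all add: christoffel_def sum_3 partial_deriv_g_tilde[OF assms] power2_eq_square)
qed

lemma partial_deriv_christoffel_g_tilde:
  assumes "x \<in> S"
  shows "partial_deriv m (christoffel (g_tilde f1 f2) k i j) x =
    (if k = 1 \<and> i = 1 \<and> j = 1 then
       if m = 1 then deriv (\<lambda>s. (p s)\<^sup>2 * deriv (\<lambda>t. 1 / (p t)\<^sup>2) s / 2) (x $ 1) else 0
     else if k = 2 \<and> (i = 2 \<and> j = 3 \<or> i = 3 \<and> j = 2) then
       if m = 3 then h'' (x $ 3) / h (x $ 3) - (h' (x $ 3) / h (x $ 3))\<^sup>2 else 0
     else if k = 3 \<and> i = 2 \<and> j = 2 then
       if m = 3 then - (h (x $ 3) * h'' (x $ 3)) - (h' (x $ 3))\<^sup>2 else 0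
     else 0)"
proof -
  have 1: "deriv (\<lambda>t. h' t / h t) (x $ 3) = h'' (x $ 3) / h (x $ 3) - (h' (x $ 3) / h (x $ 3))\<^sup>2"
    using h'[OF assms] h''[OF assms] h_nonzero[OF assms]
    by (intro DERIV_imp_deriv) (auto intro!: derivative_eq_intros simp: field_simps power2_eq_square)
  have 2: "deriv (\<lambda>t. - (h t * h' t)) (x $ 3) = - (h (x $ 3) * h'' (x $ 3)) - (h' (x $ 3))\<^sup>2"
    using h'[OF assms] h''[OF assms]
    by (intro DERIV_imp_deriv) (auto intro!: derivative_eq_intros simp: field_simps power2_eq_square)
  show ?thesis
  proof (cases "k = 1 \<and> i = 1 \<and> j = 1")
    case True
    then show ?thesis
      by (subst partial_deriv_coord[OF S assms,
            of _ "\<lambda>s. (p s)\<^sup>2 * deriv (\<lambda>t. 1 / (p t)\<^sup>2) s / 2" 1])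
         (simp_all add: christoffel_g_tilde)
  next
    case False
    \<comment> \<open>Away from Gamma^1_11 every symbol depends on the third coordinate alone, so
      one profile \<open>?q\<close> covers all these index triples.\<close>
    let ?q = "\<lambda>t. if k = 2 \<and> (i = 2 \<and> j = 3 \<or> i = 3 \<and> j = 2) then h' t / h t
      else if k = 3 \<and> i = 2 \<and> j = 2 then - (h t * h' t) else 0"
    have "partial_deriv m (christoffel (g_tilde f1 f2) k i j) x =
        (if m = 3 then deriv ?q (x $ 3) else 0)"
      by (rule partial_deriv_coord[OF S assms])
         (simp only: christoffel_g_tilde if_not_P[OF False])
    with False show ?thesis by (auto simp: 1 2)
  qed
qed

lemma riemann_g_tilde_eq_0_iff:
  assumes "x \<in> S"
  shows "(\<forall>l i j k. riemann_coeff (g_tilde f1 f2) l i j k x = 0) \<longleftrightarrow> h'' (x $ 3) = 0"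
proof
  assume "\<forall>l i j k. riemann_coeff (g_tilde f1 f2) l i j k x = 0"
  \<comment> \<open>In this component the term -(h'/h)^2 of the derivative of Gamma^2_23 cancels
    against the product Gamma^2_32 Gamma^2_23, which leaves h''/h.\<close>
  then have "riemann_coeff (g_tilde f1 f2) 2 3 2 3 x = 0" by blast
  then have "h'' (x $ 3) / h (x $ 3) = 0"
    by (simp add: riemann_coeff_def sum_3 partial_deriv_christoffel_g_tilde[OF assms]
        christoffel_g_tilde[OF assms] power2_eq_square)
  then show "h'' (x $ 3) = 0" using h_nonzero[OF assms] by simp
next
  assume 0: "h'' (x $ 3) = 0"
  \<comment> \<open>The components that do not vanish identically are h''/h and h h'' up to sign. In
    the latter the square of h' cancels against (h h') (h'/h), which uses that h is nonzero.\<close>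
  show "\<forall>l i j k. riemann_coeff (g_tilde f1 f2) l i j k x = 0"
    using 0 h_nonzero[OF assms]
    by (simp add: forall_3 riemann_coeff_def sum_3 partial_deriv_christoffel_g_tilde[OF assms]
        christoffel_g_tilde[OF assms] power2_eq_square)
qed

lemma flat_g_tilde_iff:
  assumes "smooth_on S f1" "smooth_on S f2"
  shows "flat_riemannian_on S (g_tilde f1 f2) \<longleftrightarrow> (\<forall>x\<in>S. h'' (x $ 3) = 0)"
  using riemannian_metric_g_tilde[OF S assms f1(2) f2(2)]
  by (simp add: flat_riemannian_on_def riemann_tensor_eq_0_iff riemann_g_tilde_eq_0_iff)

end

section \<open>Flatness, affine reciprocals and the two shapes of \<open>f2\<close>\<close>

theorem proposition2p4:
  fixes I1 I2 I3 :: "real set" and f1 f2 :: "real ^ 3 \<Rightarrow> real"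
  assumes "open_interval I1" and "open_interval I2" and "open_interval I3"
    and "smooth_on (box3 I1 I2 I3) f1" and "smooth_on (box3 I1 I2 I3) f2"
    and "\<forall>x\<in>box3 I1 I2 I3. f1 x \<noteq> 0" and "\<forall>x\<in>box3 I1 I2 I3. f2 x \<noteq> 0"
    and "depends_only_on_coord 1 (box3 I1 I2 I3) f1"
    and "depends_only_on_coord 3 (box3 I1 I2 I3) f2"
  shows "flat_riemannian_on (box3 I1 I2 I3) (g_tilde f1 f2) \<longleftrightarrow>
    (f2 constant_on box3 I1 I2 I3 \<or>
     (\<exists>c1 c2. c1 \<noteq> 0 \<and> c2 \<notin> I3 \<and> (\<forall>x\<in>box3 I1 I2 I3. f2 x = c1 / (x $ 3 - c2))))"
proof -
  let ?S = "box3 I1 I2 I3"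
  have S: "open ?S"
    using assms(1-3) by (intro open_box3) (auto simp: open_interval_def)
  \<comment> \<open>These points lift each \<open>t\<close> in \<open>I3\<close> to a point of the
    box, so that assertions about the box and about \<open>I3\<close> can be exchanged.\<close>
  obtain a1 a2 where a: "a1 \<in> I1" "a2 \<in> I2"
    using assms(1,2) by (auto simp: open_interval_def)
  have surj: "\<exists>x\<in>?S. x $ 3 = t" if "t \<in> I3" for t
    using a that by (intro bexI[of _ "vector [a1, a2, t]"]) (auto simp: box3_def)
  have S3: "x $ 3 \<in> I3" if "x \<in> ?S" for x
    using that by (simp add: box3_def)
  obtain p where p: "\<And>x. x \<in> ?S \<Longrightarrow> f1 x = p (x $ 1)"
    using depends_only_on_coordE[OF assms(8)] by blast
  obtain q where q: "\<And>x. x \<in> ?S \<Longrightarrow> f2 x = q (x $ 3)"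
    using depends_only_on_coordE[OF assms(9)] by blast
  define h where "h = (\<lambda>t. inverse (q t))"
  \<comment> \<open>\<open>H\<close> is the reciprocal as a function on the box, where smoothness of
    \<open>f2\<close> is available; \<open>h\<close> is its profile in the third coordinate.\<close>
  define H where "H = (\<lambda>x. inverse (f2 x))"
  have H: "H x = h (x $ 3)" if "x \<in> ?S" for x
    using q[OF that] by (simp add: h_def H_def)
  have f2: "f2 x = 1 / h (x $ 3)" if "x \<in> ?S" for x
    using q[OF that] by (simp add: h_def field_simps)
  \<comment> \<open>Class C^2 makes both \<open>H\<close> and its third partial derivative
    differentiable, which gives the two derivatives of \<open>h\<close>.\<close>
  have "Ck_on (Suc (Suc 0)) ?S H"
    unfolding H_def using S assms(5,7) by (intro Ck_on_inverse) (auto simp: smooth_on_def)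
  then have diff: "H differentiable (at x)" "partial_deriv 3 H differentiable (at x)" if "x \<in> ?S" for x
    using S that by (auto simp: differentiable_on_eq_differentiable_at)
  have H': "partial_deriv 3 H x = deriv h (x $ 3)" if "x \<in> ?S" for x
    using partial_deriv_coord[where i = 3 and p = h and k = 3, OF S that H] by simp
  have h': "(h has_real_derivative deriv h (x $ 3)) (at (x $ 3))" if "x \<in> ?S" for x
    using differentiable_coord[where p = h and k = 3, OF S that H diff(1)[OF that]] .
  \<comment> \<open>The same transfer is applied once more, now to the third partial derivative of
    \<open>H\<close>, whose profile is \<open>deriv h\<close>.\<close>
  have h'': "(deriv h has_real_derivative deriv (deriv h) (x $ 3)) (at (x $ 3))" if "x \<in> ?S" for x
    using differentiable_coord[where p = "deriv h" and k = 3, OF S that H' diff(2)[OF that]] .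
  have nz: "h t \<noteq> 0" if "t \<in> I3" for t
    using surj[OF that] f2 assms(7) by fastforce
  have flat: "flat_riemannian_on ?S (g_tilde f1 f2) \<longleftrightarrow> (\<forall>x\<in>?S. deriv (deriv h) (x $ 3) = 0)"
    using flat_g_tilde_iff[where S = ?S and p = p and h = h and h' = "deriv h"
        and h'' = "deriv (deriv h)", OF S p _ f2 _ h' h'' assms(4,5)] assms(6,7) by blast
  show ?thesis
  proof
    assume "flat_riemannian_on ?S (g_tilde f1 f2)"
    then have 0: "(deriv h has_real_derivative 0) (at t)" if "t \<in> I3" for t
      using h'' surj[OF that] flat by auto
    obtain a b where ab: "\<And>t. t \<in> I3 \<Longrightarrow> h t = a * t + b"
      using second_derivative_zero_imp_affine[of I3 h "deriv h"] h' surj 0 assms(3)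
      unfolding open_interval_def by metis
    show "f2 constant_on ?S \<or> (\<exists>c1 c2. c1 \<noteq> 0 \<and> c2 \<notin> I3 \<and> (\<forall>x\<in>?S. f2 x = c1 / (x $ 3 - c2)))"
    proof (cases "a = 0")
      case True
      then have "f2 x = 1 / b" if "x \<in> ?S" for x
        using f2[OF that] ab[OF S3[OF that]] by simp
      then show ?thesis by (auto simp: constant_on_def)
    next
      case False
      \<comment> \<open>This is the zero of the affine function, and \<open>h\<close> has no zero on
        \<open>I3\<close>. It serves as \<open>c2\<close>, with \<open>1 / a\<close> as
        \<open>c1\<close>.\<close>
      then have "- b / a \<notin> I3"
        using ab[of "- b / a"] nz[of "- b / a"] by auto
      moreover have "f2 x = (1 / a) / (x $ 3 - - b / a)" if "x \<in> ?S" for x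
      proof -
        have "a * (x $ 3 - - b / a) = a * x $ 3 + b" using False by (simp add: field_simps)
        then show ?thesis using f2[OF that] ab[OF S3[OF that]] by simp
      qed
      ultimately show ?thesis using False by (metis divide_eq_0_iff zero_neq_one)
    qed
  next
    assume R: "f2 constant_on ?S \<or> (\<exists>c1 c2. c1 \<noteq> 0 \<and> c2 \<notin> I3 \<and> (\<forall>x\<in>?S. f2 x = c1 / (x $ 3 - c2)))"
    \<comment> \<open>Both alternatives say that the reciprocal is affine: slope 0 in the constant
      case, slope \<open>1 / c1\<close> and intercept \<open>- c2 / c1\<close> in the other.\<close>
    have "\<exists>a b. \<forall>t\<in>I3. h t = a * t + b"
      using R
    proof
      assume "f2 constant_on ?S"
      then obtain c where "\<And>x. x \<in> ?S \<Longrightarrow> f2 x = c" by (auto simp: constant_on_def)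
      then have "h t = 0 * t + inverse c" if "t \<in> I3" for t
        using surj[OF that] f2 by fastforce
      then show ?thesis by blast
    next
      assume "\<exists>c1 c2. c1 \<noteq> 0 \<and> c2 \<notin> I3 \<and> (\<forall>x\<in>?S. f2 x = c1 / (x $ 3 - c2))"
      then obtain c1 c2 where c: "\<And>x. x \<in> ?S \<Longrightarrow> f2 x = c1 / (x $ 3 - c2)" by blast
      have "h t = (1 / c1) * t + (- c2 / c1)" if "t \<in> I3" for t
      proof -
        obtain x where x: "x \<in> ?S" "x $ 3 = t" using surj[OF \<open>t \<in> I3\<close>] by blast
        have "h t = inverse (c1 / (t - c2))" using H[OF x(1)] c[OF x(1)] x(2) by (simp add: H_def)
        then show ?thesis by (simp add: diff_divide_distrib)
      qed
      then show ?thesis by blast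
    qed
    then obtain a b where ab: "\<And>t. t \<in> I3 \<Longrightarrow> h t = a * t + b" by blast
    have I3: "open I3" using assms(3) by (simp add: open_interval_def)
    \<comment> \<open>Since \<open>I3\<close> is open, \<open>deriv h\<close> equals
      \<open>a\<close> near each of its points and can itself be differentiated there.\<close>
    have dh: "deriv h t = a" if "t \<in> I3" for t
    proof -
      have "((\<lambda>t. a * t + b) has_real_derivative a) (at t)"
        by (auto intro!: derivative_eq_intros)
      then show ?thesis
        by (rule DERIV_imp_deriv[OF has_field_derivative_transform_within_open[OF _ I3 that]]) (simp_all add: ab)
    qed
    have "deriv (deriv h) t = 0" if "t \<in> I3" for t
    proof -
      have "((\<lambda>t. a) has_real_derivative 0) (at t)" by simp
      then show ?thesis
        by (rule DERIV_imp_deriv[OF has_field_derivative_transform_within_open[OF _ I3 that]]) (simp_all add: dh)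
    qed
    then show "flat_riemannian_on ?S (g_tilde f1 f2)" using flat S3 by blast
  qed
qed

end
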